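(* Let $X$ be a (real or complex) Banach space, let $X_1,\dots,X_n$ be complemented subspaces of $X$, and let $P_1,\dots,P_n$ be (continuous linear) projections onto $X_1,\dots,X_n$, respectively. Suppose nonnegative numbers $\varepsilon_{ij}$ ($i\neq j$, $i,j\in\{1,\dots,n\}$) satisfy $$\|P_i x\|\leqslant \varepsilon_{ij}\|x\|,\qquad x\in X_j,$$ for every $i\neq j$. Let $E=(e_{ij})$ be the $n\times n$ matrix with $e_{ii}=0$ and $e_{ij}=\varepsilon_{ij}$ for $i\neq j$, let $r(E)$ be its spectral radius, and set $A=P_1+\dots+P_n$. If $r(E)<1$, then the subspaces $X_1,\dots,X_n$ are linearly independent, their sum $X_1+\dots+X_n$ is complemented in $X$, and the subspace $\ker(P_1)\cap\dots\cap\ker(P_n)$ is a complement of $X_1+\dots+X_n$ in $X$. Moreover, the sequence of operators $I-(I-A)^N$ converges uniformly (i.e. in operator norm), as $N\to\infty$, to the projection $P$ onto $X_1+\dots+X_n$ along $\ker(P_1)\cap\dots\cap\ker(P_n)$.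
   Context: A subspace means a linear subset (not assumed closed). A subspace $M$ of $X$ is complemented in $X$ if there is a subspace $N$ (a complement of $M$) such that $X$ is the topological direct sum of $M$ and $N$, i.e. $(x,y)\mapsto x+y$ is an isomorphism of normed spaces from $M\times N$ (norm $\|x\|+\|y\|$) onto $X$; equivalently, there is a continuous linear projection of $X$ onto $M$. All projections are continuous linear operators $P:X\to X$ with $Px\in M$ for all $x\in X$ and $Px=x$ for $x\in M$. The sum is $X_1+\dots+X_n=\{x_1+\dots+x_n\mid x_i\in X_i\}$. Subspaces $X_1,\dots,X_n$ are linearly independent if $x_1+\dots+x_n=0$ with $x_i\in X_i$ implies $x_1=\dots=x_n=0$. $I$ is the identity operator on $X$. *)

theory Defs
  imports "HOL-Analysis.Operator_Norm" "Jordan_Normal_Form.Spectral_Radius"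
begin

text \<open>
  The type class \<open>banach\<close> only provides real scalars.  To treat real and complex spaces
  alike, the scalar multiplication \<open>scale\<close> is explicit.  Its scalar field is a normed
  \<open>\<real>\<close>-algebra with multiplicative norm, which by the Gelfand--Mazur theorem means
  \<open>\<real>\<close> or \<open>\<complex>\<close>; \<open>scale\<close> must extend the scalar multiplication by reals of the type class.
\<close>

locale normed_scaling = vector_space scale
  for scale :: "'k::real_normed_field \<Rightarrow> 'a::real_normed_vector \<Rightarrow> 'a" +
  assumes norm_scale: "norm (scale c x) = norm c * norm x"
    and scale_of_real: "scale (of_real r) x = r *\<^sub>R x"

lemma normed_scaling_real: "normed_scaling (scaleR :: real \<Rightarrow> 'a::real_normed_vector \<Rightarrow> 'a)"
  by unfold_locales (auto simp: scaleR_add_right scaleR_add_left)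

lemma normed_scaling_complex: "normed_scaling ((*) :: complex \<Rightarrow> complex \<Rightarrow> complex)"
  by unfold_locales (auto simp: algebra_simps norm_mult scaleR_conv_of_real)

text \<open>
  \<open>N\<close> is a complement of \<open>M\<close>: addition is an isomorphism of normed spaces from \<open>M \<times> N\<close> onto
  the whole space.  The norm \<open>\<parallel>x\<parallel> + \<parallel>y\<parallel>\<close> on \<open>M \<times> N\<close> is written out, because the norm of the
  product type is the Euclidean one.  Linearity of addition holds in every vector space.
\<close>

definition is_complement ::
  "('k::real_normed_field \<Rightarrow> 'a::real_normed_vector \<Rightarrow> 'a) \<Rightarrow> 'a set \<Rightarrow> 'a set \<Rightarrow> bool" where
  "is_complement scale M N \<longleftrightarrow>
     module.subspace scale M \<and> module.subspace scale N \<and>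
     bij_betw (\<lambda>(x, y). x + y) (M \<times> N) UNIV \<and>
     (\<exists>C. \<forall>x\<in>M. \<forall>y\<in>N. norm (x + y) \<le> C * (norm x + norm y)) \<and>
     (\<exists>C. \<forall>x\<in>M. \<forall>y\<in>N. norm x + norm y \<le> C * norm (x + y))"

definition complemented ::
  "('k::real_normed_field \<Rightarrow> 'a::real_normed_vector \<Rightarrow> 'a) \<Rightarrow> 'a set \<Rightarrow> bool" where
  "complemented scale M \<longleftrightarrow> (\<exists>N. is_complement scale M N)"

definition is_projection_onto ::
  "('k::real_normed_field \<Rightarrow> 'a::real_normed_vector \<Rightarrow> 'a) \<Rightarrow> ('a \<Rightarrow> 'a) \<Rightarrow> 'a set \<Rightarrow> bool" where
  "is_projection_onto scale P M \<longleftrightarrow>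
     Vector_Spaces.linear scale scale P \<and> continuous_on UNIV P \<and>
     (\<forall>x. P x \<in> M) \<and> (\<forall>x\<in>M. P x = x)"

definition null_space :: "('a \<Rightarrow> 'b::zero) \<Rightarrow> 'a set" where
  "null_space f = {x. f x = 0}"

definition subspace_sum :: "nat \<Rightarrow> (nat \<Rightarrow> 'a::comm_monoid_add set) \<Rightarrow> 'a set" where
  "subspace_sum n X = {\<Sum>i<n. x i | x. \<forall>i<n. x i \<in> X i}"

definition subspaces_independent :: "nat \<Rightarrow> (nat \<Rightarrow> 'a::comm_monoid_add set) \<Rightarrow> bool" where
  "subspaces_independent n X \<longleftrightarrow>
     (\<forall>x. (\<forall>i<n. x i \<in> X i) \<and> (\<Sum>i<n. x i) = 0 \<longrightarrow> (\<forall>i<n. x i = 0))"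

text \<open>The entries are embedded in \<open>\<complex>\<close>, where the spectrum is taken.\<close>

definition offdiag_mat :: "nat \<Rightarrow> (nat \<Rightarrow> nat \<Rightarrow> real) \<Rightarrow> complex mat" where
  "offdiag_mat n \<epsilon> = Matrix.mat n n (\<lambda>(i, j). if i = j then 0 else complex_of_real (\<epsilon> i j))"

end

theory Submission
  imports Defs
begin

text \<open>
  Everything rests on one computation. Put \<open>T = I - A\<close>. Since \<open>P\<^sub>i\<close> fixes \<open>X\<^sub>i\<close>, the diagonal term in
  \<open>P\<^sub>i (T x) = P\<^sub>i x - (\<Sum>j. P\<^sub>i (P\<^sub>j x))\<close> cancels, and \<open>P\<^sub>j x \<in> X\<^sub>j\<close> gives
  \<open>\<parallel>P\<^sub>i (T x)\<parallel> \<le> (\<Sum>j\<noteq>i. \<epsilon>\<^sub>i\<^sub>j \<parallel>P\<^sub>j x\<parallel>)\<close> (lemma \<open>norm_P_T_le\<close>). So the vectors of norms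
  \<open>(\<parallel>P\<^sub>i (T\<^sup>k x)\<parallel>)\<^sub>i\<close> are dominated by \<open>E\<^sup>k\<close> applied to \<open>(\<parallel>P\<^sub>i x\<parallel>)\<^sub>i\<close>, and \<open>r(E) < 1\<close> makes them
  decay like \<open>\<rho>\<^sup>k \<parallel>x\<parallel>\<close> for some \<open>\<rho> < 1\<close> (lemma \<open>norm_P_T_pow_le\<close>).
  
  As \<open>T\<^sup>k x - T\<^sup>k\<^sup>+\<^sup>1 x = A (T\<^sup>k x)\<close>, the operators \<open>I - T\<^sup>N\<close> are the partial sums of the series of the
  operators \<open>A T\<^sup>k\<close>, which therefore converges in operator norm. Its sum
  \<open>Q x = (\<Sum>i. \<Sum>k. P\<^sub>i (T\<^sup>k x))\<close> lies in \<open>X\<^sub>1 + \<dots> + X\<^sub>n\<close>, because the range of a continuous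
  projection is closed; and \<open>P\<^sub>i (x - Q x) = lim P\<^sub>i (T\<^sup>k x) = 0\<close> for every \<open>i\<close>.
  
  The same inequality gives independence in a strong form: if \<open>x\<^sub>i \<in> X\<^sub>i\<close> and every \<open>P\<^sub>i\<close> annihilates
  the sum of the \<open>x\<^sub>j\<close>, then \<open>v\<^sub>i = \<parallel>x\<^sub>i\<parallel>\<close> satisfies \<open>v \<le> E v\<close>, hence \<open>v \<le> E\<^sup>k v \<longlonglongrightarrow> 0\<close>
  (lemma \<open>summands_eq_0_if_P_sum_eq_0\<close>). Thus the sum of the subspaces meets the common kernel of the
  \<open>P\<^sub>i\<close> only in \<open>0\<close>. For \<open>x\<close> in the sum, \<open>x - Q x\<close> lies in both, so \<open>Q x = x\<close>. Hence \<open>Q\<close> is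
  a projection onto the sum, and its kernel is the common kernel of the \<open>P\<^sub>i\<close>.
\<close>

section \<open>Inequalities between norm vectors and the spectral radius\<close>

text \<open>
  The powers of a matrix of spectral radius below \<open>1\<close> are bounded. Dividing the entries by a \<open>\<rho>\<close>
  strictly between the spectral radius and \<open>1\<close> leaves the spectral radius below \<open>1\<close>, which turns
  this boundedness into decay of order \<open>\<rho>\<^sup>k\<close> for the original matrix.
\<close>
lemma spectral_radius_offdiag_scaled_less_1:
  assumes n: "n \<ge> 1" and \<rho>: "0 < \<rho>" and sr: "spectral_radius (offdiag_mat n \<epsilon>) < \<rho>"
  shows "spectral_radius (offdiag_mat n (\<lambda>i j. \<epsilon> i j / \<rho>)) < 1"
proof -
  let ?E = "offdiag_mat n \<epsilon>" and ?F = "offdiag_mat n (\<lambda>i j. \<epsilon> i j / \<rho>)"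
  have E: "?E \<in> carrier_mat n n" and F: "?F \<in> carrier_mat n n"
    by (auto simp: offdiag_mat_def)
  have EF: "?E = complex_of_real \<rho> \<cdot>\<^sub>m ?F"
    using \<rho> by (intro eq_matI) (auto simp: offdiag_mat_def)
  obtain \<mu> where \<mu>: "\<mu> \<in> spectrum ?F" "spectral_radius ?F = norm \<mu>"
    using spectral_radius_mem_max(1)[OF F] n by auto
  then obtain v where v: "v \<in> carrier_vec n" "v \<noteq> 0\<^sub>v n" "?F *\<^sub>v v = \<mu> \<cdot>\<^sub>v v"
    using F unfolding spectrum_def eigenvalue_def eigenvector_def by auto
  have "?E *\<^sub>v v = complex_of_real \<rho> \<cdot>\<^sub>v (?F *\<^sub>v v)"
    unfolding EF using F v(1) by (intro eq_vecI) (auto simp: scalar_prod_def sum_distrib_left mult.assoc)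
  also have "\<dots> = (complex_of_real \<rho> * \<mu>) \<cdot>\<^sub>v v"
    unfolding v(3) by (rule smult_smult_assoc)
  finally have "complex_of_real \<rho> * \<mu> \<in> spectrum ?E"
    using E v(1,2) unfolding spectrum_def eigenvalue_def eigenvector_def by auto
  then have "norm (complex_of_real \<rho> * \<mu>) \<le> spectral_radius ?E"
    using spectral_radius_mem_max(2)[OF E] n by auto
  then have "\<rho> * norm \<mu> \<le> spectral_radius ?E"
    using \<rho> by (simp add: norm_mult)
  then have "\<rho> * norm \<mu> < \<rho> * 1"
    using sr unfolding mult_1_right by (rule le_less_trans)
  then show ?thesis
    unfolding \<mu>(2) mult_less_cancel_left_pos[OF \<rho>] .
qed

text \<open>
  The inequality \<open>v\<^sub>k\<^sub>+\<^sub>1 \<le> E v\<^sub>k\<close> between nonnegative vectors; the sum leaves out \<open>j = i\<close>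
  because \<open>E\<close> has diagonal \<open>0\<close>, whatever the values \<open>\<epsilon> i i\<close> are.
\<close>
definition dominated_iteration ::
  "nat \<Rightarrow> (nat \<Rightarrow> nat \<Rightarrow> real) \<Rightarrow> (nat \<Rightarrow> nat \<Rightarrow> real) \<Rightarrow> bool" where
  "dominated_iteration n \<epsilon> v \<longleftrightarrow>
     (\<forall>k. \<forall>i<n. 0 \<le> v k i \<and> v (Suc k) i \<le> (\<Sum>j\<in>{..<n} - {i}. \<epsilon> i j * v k j))"

lemma dominated_iterationI:
  assumes "\<And>k i. i < n \<Longrightarrow> 0 \<le> v k i"
    and "\<And>k i. i < n \<Longrightarrow> v (Suc k) i \<le> (\<Sum>j\<in>{..<n} - {i}. \<epsilon> i j * v k j)"
  shows "dominated_iteration n \<epsilon> v"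
  using assms by (simp add: dominated_iteration_def)

lemma dominated_iterationD:
  assumes "dominated_iteration n \<epsilon> v" "i < n"
  shows "0 \<le> v k i" and "v (Suc k) i \<le> (\<Sum>j\<in>{..<n} - {i}. \<epsilon> i j * v k j)"
  using assms by (simp_all add: dominated_iteration_def)

lemma dominated_iteration_Suc:
  "dominated_iteration n \<epsilon> v \<Longrightarrow> dominated_iteration n \<epsilon> (\<lambda>k. v (Suc k))"
  unfolding dominated_iteration_def by blast

text \<open>
  Iterating the inequality gives \<open>w\<^sub>k \<le> F\<^sup>k w\<^sub>0\<close>, as the entries of \<open>F\<close> are nonnegative; the entries
  of all the powers \<open>F\<^sup>k\<close> have a common bound because the spectral radius of \<open>F\<close> is below \<open>1\<close>.
\<close>
lemma offdiag_iteration_bounded: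
  assumes nonneg: "\<And>i j. i < n \<Longrightarrow> j < n \<Longrightarrow> i \<noteq> j \<Longrightarrow> 0 \<le> \<delta> i j"
    and sr: "spectral_radius (offdiag_mat n \<delta>) < 1"
  obtains c where "0 \<le> c"
    and "\<forall>w k i. dominated_iteration n \<delta> w \<longrightarrow> i < n \<longrightarrow> w k i \<le> c * (\<Sum>j<n. w 0 j)"
proof -
  let ?F = "offdiag_mat n \<delta>"
  have F: "?F \<in> carrier_mat n n" by (auto simp: offdiag_mat_def)
  obtain c where c: "\<And>k. norm_bound (?F ^\<^sub>m k) c"
    using spectral_radius_jnf_norm_bound_less_1_upper_triangular[OF F sr] by blast
  define \<phi> where "\<phi> i j = (if i = j then 0 else \<delta> i j)" for i j
  have \<phi>: "0 \<le> \<phi> i j" if "i < n" "j < n" for i j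
    using that nonneg by (auto simp: \<phi>_def)
  \<comment> \<open>\<open>f k\<close> is the \<open>k\<close>-th power computed over the reals, where the entries can be compared.\<close>
  define f where "f = rec_nat (\<lambda>i j. if i = j then 1 else 0) (\<lambda>_ g i j. \<Sum>l<n. g i l * \<phi> l j)"
  have f0: "f 0 i j = (if i = j then 1 else 0)" for i j by (simp add: f_def)
  have fS: "f (Suc k) i j = (\<Sum>l<n. f k i l * \<phi> l j)" for k i j by (simp add: f_def)
  have pow: "(?F ^\<^sub>m k) $$ (i, j) = complex_of_real (f k i j)" if "i < n" "j < n" for k i j
    using that
  proof (induction k arbitrary: j)
    case 0
    then show ?case using F by (simp add: f0)
  next
    case (Suc k)
    have car: "?F ^\<^sub>m k \<in> carrier_mat n n" using F by simp
    have "(?F ^\<^sub>m Suc k) $$ (i, j) = (\<Sum>l = 0..<n. (?F ^\<^sub>m k) $$ (i, l) * ?F $$ (l, j))"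
      using Suc.prems F car by (simp add: scalar_prod_def)
    also have "\<dots> = (\<Sum>l = 0..<n. complex_of_real (f k i l * \<phi> l j))"
      using Suc by (intro sum.cong) (auto simp: offdiag_mat_def \<phi>_def)
    finally show ?case by (simp add: fS atLeast0LessThan)
  qed
  have fnn: "0 \<le> f k i j" if "i < n" "j < n" for k i j
    using that
  proof (induction k arbitrary: j)
    case (Suc k)
    then show ?case
      unfolding fS by (intro sum_nonneg mult_nonneg_nonneg Suc.IH \<phi>) auto
  qed (simp add: f0)
  have fc: "f k i j \<le> max c 0" if "i < n" "j < n" for k i j
  proof -
    have "norm ((?F ^\<^sub>m k) $$ (i, j)) \<le> c"
      using c[of k] that F unfolding norm_bound_def by simp
    then show ?thesis using that by (simp add: pow)
  qed
  have main: "w k i \<le> (\<Sum>j<n. f k i j * w 0 j)"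
    if "dominated_iteration n \<delta> w" "i < n" for w k i
    using that
  proof (induction k arbitrary: w)
    case 0
    have "(\<Sum>j<n. f 0 i j * w 0 j) = (\<Sum>j<n. if i = j then w 0 j else 0)"
      by (intro sum.cong) (auto simp: f0)
    then show ?case using 0 by simp
  next
    case (Suc k)
    \<comment> \<open>Using the induction hypothesis for the shifted sequence leaves the first step of the iteration,
      which multiplies by \<open>F\<close> on the right, as the recursion for \<open>f\<close> does.\<close>
    have "w (Suc k) i \<le> (\<Sum>l<n. f k i l * w (Suc 0) l)"
      by (rule Suc.IH[of "\<lambda>k. w (Suc k)", OF dominated_iteration_Suc[OF Suc.prems(1)] Suc.prems(2)])
    also have "\<dots> \<le> (\<Sum>l<n. f k i l * (\<Sum>j<n. \<phi> l j * w 0 j))"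
    proof (intro sum_mono mult_left_mono)
      fix l assume l: "l \<in> {..<n}"
      have "w (Suc 0) l \<le> (\<Sum>j\<in>{..<n} - {l}. \<delta> l j * w 0 j)" 
        using dominated_iterationD(2)[OF Suc.prems(1), of l 0] l by simp
      also have "\<dots> = (\<Sum>j\<in>{..<n} - {l}. \<phi> l j * w 0 j)"
        by (intro sum.cong) (auto simp: \<phi>_def)
      also have "\<dots> = (\<Sum>j<n. \<phi> l j * w 0 j)"
        by (intro sum.mono_neutral_left) (auto simp: \<phi>_def)
      finally show "w (Suc 0) l \<le> (\<Sum>j<n. \<phi> l j * w 0 j)" .
      show "0 \<le> f k i l" using fnn Suc.prems(2) l by simp
    qed
    also have "\<dots> = (\<Sum>l<n. \<Sum>j<n. f k i l * \<phi> l j * w 0 j)"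
      by (simp add: sum_distrib_left mult.assoc)
    also have "\<dots> = (\<Sum>j<n. f (Suc k) i j * w 0 j)"
      by (subst sum.swap) (simp add: fS sum_distrib_right)
    finally show ?case .
  qed
  show thesis
  proof (rule that[of "max c 0"], simp, intro allI impI)
    fix w :: "nat \<Rightarrow> nat \<Rightarrow> real" and k i
    assume w: "dominated_iteration n \<delta> w" and i: "i < n"
    have "w k i \<le> (\<Sum>j<n. f k i j * w 0 j)" by (rule main[OF w i])
    also have "\<dots> \<le> (\<Sum>j<n. max c 0 * w 0 j)"
      by (intro sum_mono mult_right_mono) (auto intro: fc i dominated_iterationD(1)[OF w])
    finally show "w k i \<le> max c 0 * (\<Sum>j<n. w 0 j)" by (simp add: sum_distrib_left)
  qed
qed

text \<open>
  The sequence \<open>v\<^sub>k / \<rho>\<^sup>k\<close> satisfies the same inequality for the matrix \<open>E / \<rho>\<close>, whose spectral radius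
  is still below \<open>1\<close>; so it is bounded. The constants do not depend on the sequence, which is what
  later makes the convergence uniform.
\<close>
lemma offdiag_iteration_decay:
  assumes n: "n \<ge> 1"
    and nonneg: "\<And>i j. i < n \<Longrightarrow> j < n \<Longrightarrow> i \<noteq> j \<Longrightarrow> 0 \<le> \<epsilon> i j"
    and sr: "spectral_radius (offdiag_mat n \<epsilon>) < 1"
  obtains c \<rho> where "0 \<le> c" "0 < \<rho>" "\<rho> < 1"
    and "\<forall>v k i. dominated_iteration n \<epsilon> v \<longrightarrow> i < n \<longrightarrow> v k i \<le> c * \<rho> ^ k * (\<Sum>j<n. v 0 j)"
proof -
  have "0 \<le> spectral_radius (offdiag_mat n \<epsilon>)"
    using spectral_radius_mem_max(1)[of "offdiag_mat n \<epsilon>" n] n by (auto simp: offdiag_mat_def)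
  moreover obtain \<rho> where \<rho>: "spectral_radius (offdiag_mat n \<epsilon>) < \<rho>" "\<rho> < 1"
    using dense[OF sr] by blast
  ultimately have \<rho>0: "0 < \<rho>" by linarith
  have "0 \<le> \<epsilon> i j / \<rho>" if "i < n" "j < n" "i \<noteq> j" for i j
    using nonneg that \<rho>0 by simp
  then obtain c where c: "0 \<le> c"
    and cw: "\<forall>w k i. dominated_iteration n (\<lambda>i j. \<epsilon> i j / \<rho>) w \<longrightarrow> i < n \<longrightarrow> w k i \<le> c * (\<Sum>j<n. w 0 j)"
    by (rule offdiag_iteration_bounded[of n "\<lambda>i j. \<epsilon> i j / \<rho>",
          OF _ spectral_radius_offdiag_scaled_less_1[OF n \<rho>0 \<rho>(1)]])
  show thesis
  proof (rule that[OF c \<rho>0 \<rho>(2)], intro allI impI)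
    fix v :: "nat \<Rightarrow> nat \<Rightarrow> real" and k i
    assume v: "dominated_iteration n \<epsilon> v" and i: "i < n"
    define w where "w k i = v k i / \<rho> ^ k" for k i
    have "w k i \<le> c * (\<Sum>j<n. w 0 j)"
    proof (rule cw[rule_format, OF dominated_iterationI i])
      show "0 \<le> w k i" if "i < n" for k i
        using dominated_iterationD(1)[OF v that] \<rho>0 by (simp add: w_def)
      fix k i assume i: "i < n"
      have "w (Suc k) i \<le> (\<Sum>j\<in>{..<n} - {i}. \<epsilon> i j * v k j) / \<rho> ^ Suc k"
        unfolding w_def using \<rho>0 by (intro divide_right_mono dominated_iterationD(2)[OF v i]) simp
      also have "\<dots> = (\<Sum>j\<in>{..<n} - {i}. (\<epsilon> i j / \<rho>) * w k j)"
        by (simp add: w_def sum_divide_distrib)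
      finally show "w (Suc k) i \<le> (\<Sum>j\<in>{..<n} - {i}. (\<epsilon> i j / \<rho>) * w k j)" .
    qed
    then have "v k i / \<rho> ^ k \<le> c * (\<Sum>j<n. v 0 j)" by (simp add: w_def)
    then show "v k i \<le> c * \<rho> ^ k * (\<Sum>j<n. v 0 j)"
      using \<rho>0 by (simp add: divide_le_eq mult.commute mult.left_commute)
  qed
qed

text \<open>
  The constant sequence \<open>v\<close> is a dominated iteration, and so it must decay.
\<close>
lemma offdiag_subinvariant_eq_0:
  assumes n: "n \<ge> 1"
    and nonneg: "\<And>i j. i < n \<Longrightarrow> j < n \<Longrightarrow> i \<noteq> j \<Longrightarrow> 0 \<le> \<epsilon> i j"
    and sr: "spectral_radius (offdiag_mat n \<epsilon>) < 1"
    and v: "\<And>i. i < n \<Longrightarrow> 0 \<le> v i"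
    and le: "\<And>i. i < n \<Longrightarrow> v i \<le> (\<Sum>j\<in>{..<n} - {i}. \<epsilon> i j * v j)"
    and i: "i < n"
  shows "v i = (0::real)"
proof -
  obtain c \<rho> where "0 \<le> c" and \<rho>: "0 < \<rho>" "\<rho> < 1"
    and dec: "\<forall>v k i. dominated_iteration n \<epsilon> v \<longrightarrow> i < n \<longrightarrow> v k i \<le> c * \<rho> ^ k * (\<Sum>j<n. v 0 j)"
    by (rule offdiag_iteration_decay[of n \<epsilon>, OF n nonneg sr])
  have "dominated_iteration n \<epsilon> (\<lambda>_. v)"
    by (rule dominated_iterationI) (rule v le, assumption)+
  from dec[rule_format, OF this i] have bound: "v i \<le> c * \<rho> ^ k * (\<Sum>j<n. v j)" for k .
  have lim: "(\<lambda>k. c * \<rho> ^ k * (\<Sum>j<n. v j)) \<longlonglongrightarrow> c * 0 * (\<Sum>j<n. v j)"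
    using \<rho> by (intro tendsto_intros LIMSEQ_realpow_zero) auto
  have "v i \<le> c * 0 * (\<Sum>j<n. v j)"
    using bound by (intro LIMSEQ_le_const[OF lim]) blast
  then show ?thesis using v[OF i] by simp
qed

section \<open>Continuous linear maps and projections\<close>

context normed_scaling
begin

lemma linear_scaleI:
  assumes "\<And>x y. f (x + y) = f x + f y" "\<And>c x. f (scale c x) = scale c (f x)"
  shows "Vector_Spaces.linear scale scale f"
  using assms by unfold_locales (auto simp: scale_right_distrib scale_left_distrib)

lemma bounded_linear_scale: "bounded_linear (scale c)"
proof
  show "scale c (x + y) = scale c x + scale c y" for x y by (rule scale_right_distrib)
  show "scale c (r *\<^sub>R x) = r *\<^sub>R scale c x" for r x
    by (metis scale_left_commute scale_of_real)
  show "\<exists>K. \<forall>x. norm (scale c x) \<le> norm x * K"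
    by (rule exI[of _ "norm c"]) (simp add: norm_scale mult.commute)
qed

lemma linear_imp_real_linear:
  assumes "Vector_Spaces.linear scale scale f"
  shows "linear f"
proof -
  interpret f: Vector_Spaces.linear scale scale f by fact
  show ?thesis
    by (rule linearI) (metis f.add, metis f.scale scale_of_real)
qed

text \<open>
  A continuous linear map is bounded on a ball around \<open>0\<close>, hence everywhere by homogeneity.
\<close>
lemma continuous_linear_imp_bounded_linear:
  assumes f: "Vector_Spaces.linear scale scale f" and cont: "continuous_on UNIV f"
  shows "bounded_linear f"
proof -
  interpret f: linear f by (rule linear_imp_real_linear[OF f])
  have "isCont f 0" using cont by (simp add: continuous_on_eq_continuous_at)
  then obtain d where d: "d > 0" "\<And>x. x \<noteq> 0 \<Longrightarrow> norm x < d \<Longrightarrow> norm (f x) < 1"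
    using LIM_D[of f "f 0" 0 1] unfolding isCont_def by (auto simp: f.zero)
  have "norm (f x) \<le> norm x * (2 / d)" for x
  proof (cases "x = 0")
    case False
    let ?r = "d / (2 * norm x)"
    have "norm (?r *\<^sub>R x) < d" using False d(1) by (simp)
    from d(2)[OF _ this] have "?r * norm (f x) < 1" using False d(1) by (simp add: f.scale)
    then show ?thesis using False d(1) by (simp add: field_simps)
  qed (simp add: f.zero)
  then show ?thesis
    by (intro bounded_linear.intro f.linear_axioms bounded_linear_axioms.intro) blast
qed

lemma is_projection_onto_imp_subspace:
  assumes "is_projection_onto scale P M"
  shows "subspace M"
proof -
  interpret P: Vector_Spaces.linear scale scale P
    using assms by (simp add: is_projection_onto_def)
  have M: "M = {x. P x = x}"
    using assms by (auto simp: is_projection_onto_def) metis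
  show ?thesis unfolding M by (rule subspaceI) (auto simp: P.zero P.add P.scale)
qed

text \<open>
  The decomposition is \<open>z = Q z + (z - Q z)\<close>; the two norm estimates that make it topological are the
  triangle inequality and the boundedness of \<open>Q\<close>.
\<close>
lemma is_complement_null_space:
  assumes Q: "is_projection_onto scale Q M"
  shows "is_complement scale M (null_space Q)"
proof -
  interpret Q: Vector_Spaces.linear scale scale Q
    using Q by (simp add: is_projection_onto_def)
  have range: "Q x \<in> M" and fixed: "x \<in> M \<Longrightarrow> Q x = x" for x
    using Q by (auto simp: is_projection_onto_def)
  interpret bQ: bounded_linear Q
    using Q by (intro continuous_linear_imp_bounded_linear) (auto simp: is_projection_onto_def)
  have Qsum: "Q (x + y) = x" if "x \<in> M" "y \<in> null_space Q" for x y
    using that by (simp add: Q.add fixed null_space_def)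
  have "bij_betw (\<lambda>(x, y). x + y) (M \<times> null_space Q) UNIV"
  proof (rule bij_betw_byWitness[where f' = "\<lambda>z. (Q z, z - Q z)"])
    show "\<forall>a\<in>M \<times> null_space Q. (Q (case a of (x, y) \<Rightarrow> x + y), (case a of (x, y) \<Rightarrow> x + y) - Q (case a of (x, y) \<Rightarrow> x + y)) = a"
      by (auto simp: Qsum)
    show "(\<lambda>z. (Q z, z - Q z)) ` UNIV \<subseteq> M \<times> null_space Q"
      by (auto simp: range fixed Q.diff null_space_def)
  qed auto
  moreover have "subspace (null_space Q)"
    unfolding null_space_def by (rule Q.subspace_kernel)
  moreover have "\<exists>C. \<forall>x\<in>M. \<forall>y\<in>null_space Q. norm (x + y) \<le> C * (norm x + norm y)"
    by (rule exI[of _ 1]) (auto intro: norm_triangle_ineq)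
  moreover have "\<exists>C. \<forall>x\<in>M. \<forall>y\<in>null_space Q. norm x + norm y \<le> C * norm (x + y)"
  proof (intro exI ballI)
    fix x y assume xy: "x \<in> M" "y \<in> null_space Q"
    have "norm x \<le> onorm Q * norm (x + y)"
      using onorm[OF bQ.bounded_linear_axioms, of "x + y"] by (simp add: Qsum xy)
    moreover have "norm y \<le> norm (x + y) + norm x"
      using norm_triangle_ineq4[of "x + y" x] by simp
    ultimately show "norm x + norm y \<le> (2 * onorm Q + 1) * norm (x + y)"
      by (simp add: algebra_simps)
  qed
  ultimately show ?thesis
    using is_projection_onto_imp_subspace[OF Q] by (simp add: is_complement_def)
qed

end

section \<open>Projections with small mutual interaction\<close>

locale small_interaction_projections = normed_scaling scale
  for scale :: "'k::real_normed_field \<Rightarrow> 'a::banach \<Rightarrow> 'a" +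
  fixes n :: nat and X :: "nat \<Rightarrow> 'a set" and P :: "nat \<Rightarrow> 'a \<Rightarrow> 'a"
    and \<epsilon> :: "nat \<Rightarrow> nat \<Rightarrow> real"
  assumes n_ge_1: "n \<ge> 1"
    and projection: "\<And>i. i < n \<Longrightarrow> is_projection_onto scale (P i) (X i)"
    and \<epsilon>_nonneg: "\<And>i j. i < n \<Longrightarrow> j < n \<Longrightarrow> i \<noteq> j \<Longrightarrow> 0 \<le> \<epsilon> i j"
    and norm_P_le: "\<And>i j x. i < n \<Longrightarrow> j < n \<Longrightarrow> i \<noteq> j \<Longrightarrow> x \<in> X j \<Longrightarrow> norm (P i x) \<le> \<epsilon> i j * norm x"
    and spectral_radius_less_1: "spectral_radius (offdiag_mat n \<epsilon>) < 1"
begin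

definition T :: "'a \<Rightarrow> 'a" where "T x = x - (\<Sum>i<n. P i x)"

text \<open>
  The sum of the series of the operators \<open>A T\<^sup>k\<close>. The sum over \<open>i\<close> is outside, so that each inner
  series converges inside a single \<open>X\<^sub>i\<close>.
\<close>
definition Q :: "'a \<Rightarrow> 'a" where "Q x = (\<Sum>i<n. \<Sum>k. P i ((T ^^ k) x))"

lemma P_range: "i < n \<Longrightarrow> P i x \<in> X i"
  and P_fix: "i < n \<Longrightarrow> x \<in> X i \<Longrightarrow> P i x = x"
  and P_linear: "i < n \<Longrightarrow> Vector_Spaces.linear scale scale (P i)"
  and P_bounded_linear: "i < n \<Longrightarrow> bounded_linear (P i)"
  using projection[of i] continuous_linear_imp_bounded_linear
  by (auto simp: is_projection_onto_def)

lemma P_scale: "i < n \<Longrightarrow> P i (scale c x) = scale c (P i x)"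
  using P_linear[of i] by (simp add: Vector_Spaces.linear_iff)

lemma P_sum: "i < n \<Longrightarrow> P i (\<Sum>j\<in>J. x j) = (\<Sum>j\<in>J. P i (x j))"
  using P_bounded_linear[of i] by (rule bounded_linear.linear[THEN linear_sum])

lemma bounded_linear_T_pow: "bounded_linear (T ^^ k)"
proof (induction k)
  case 0
  show ?case by (simp add: id_def bounded_linear_ident)
next
  case (Suc k)
  have "bounded_linear T" unfolding T_def[abs_def]
    by (intro bounded_linear_sub bounded_linear_ident bounded_linear_sum P_bounded_linear) simp
  from bounded_linear_compose[OF this Suc] show ?case by (simp add: o_def)
qed

lemma T_pow_scale: "(T ^^ k) (scale c x) = scale c ((T ^^ k) x)"
  by (induction k) (simp_all add: T_def P_scale scale_right_diff_distrib scale_sum_right)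

text \<open>
  The two occurrences of \<open>P\<^sub>i x\<close>, one from \<open>I\<close> and one from \<open>P\<^sub>i P\<^sub>i\<close>, cancel. What remains involves
  \<open>P\<^sub>i\<close> only on the other subspaces \<open>X\<^sub>j\<close>, where it is small.
\<close>
lemma norm_P_T_le:
  assumes i: "i < n"
  shows "norm (P i (T x)) \<le> (\<Sum>j\<in>{..<n} - {i}. \<epsilon> i j * norm (P j x))"
proof -
  have "P i (T x) = P i x - (\<Sum>j<n. P i (P j x))"
    unfolding T_def using i
    by (simp add: P_sum bounded_linear.linear[OF P_bounded_linear, THEN linear_diff])
  also have "\<dots> = - (\<Sum>j\<in>{..<n} - {i}. P i (P j x))"
    using i by (simp add: sum.remove[of "{..<n}" i] P_fix P_range)
  also have "norm \<dots> \<le> (\<Sum>j\<in>{..<n} - {i}. norm (P i (P j x)))"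
    by (simp add: norm_sum)
  also have "\<dots> \<le> (\<Sum>j\<in>{..<n} - {i}. \<epsilon> i j * norm (P j x))"
    using i by (intro sum_mono norm_P_le) (auto simp: P_range)
  finally show ?thesis .
qed

text \<open>
  The norms \<open>\<parallel>P\<^sub>i (T\<^sup>k x)\<parallel>\<close> form a dominated iteration that starts at \<open>\<parallel>P\<^sub>i x\<parallel>\<close>, and
  \<open>\<parallel>P\<^sub>i x\<parallel> \<le> \<parallel>P\<^sub>i\<parallel> \<parallel>x\<parallel>\<close>.
\<close>
lemma norm_P_T_pow_le:
  obtains K \<rho> where "0 \<le> K" "0 < \<rho>" "\<rho> < 1"
    "\<forall>i<n. \<forall>k x. norm (P i ((T ^^ k) x)) \<le> K * \<rho> ^ k * norm x"
proof -
  obtain c \<rho> where c: "0 \<le> c" and \<rho>: "0 < \<rho>" "\<rho> < 1"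
    and dec: "\<forall>v k i. dominated_iteration n \<epsilon> v \<longrightarrow> i < n \<longrightarrow> v k i \<le> c * \<rho> ^ k * (\<Sum>j<n. v 0 j)"
    by (rule offdiag_iteration_decay[OF n_ge_1 \<epsilon>_nonneg spectral_radius_less_1])
  have "0 \<le> c * (\<Sum>j<n. onorm (P j))"
    using c by (intro mult_nonneg_nonneg sum_nonneg onorm_pos_le P_bounded_linear) auto
  from this \<rho> show thesis
  proof (rule that, intro allI impI)
    fix i k x assume i: "i < n"
    have "norm (P i ((T ^^ k) x)) \<le> c * \<rho> ^ k * (\<Sum>j<n. norm (P j ((T ^^ 0) x)))"
      by (rule dec[rule_format, of "\<lambda>k i. norm (P i ((T ^^ k) x))"])
        (auto intro!: dominated_iterationI norm_P_T_le i)
    also have "\<dots> \<le> c * \<rho> ^ k * (\<Sum>j<n. onorm (P j) * norm x)"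
      using c \<rho> by (intro mult_left_mono sum_mono) (auto intro: onorm P_bounded_linear)
    also have "\<dots> = c * (\<Sum>j<n. onorm (P j)) * \<rho> ^ k * norm x"
      by (simp add: sum_distrib_right[symmetric])
    finally show "norm (P i ((T ^^ k) x)) \<le> c * (\<Sum>j<n. onorm (P j)) * \<rho> ^ k * norm x" .
  qed
qed

lemma summable_P_T_pow:
  assumes i: "i < n"
  shows "summable (\<lambda>k. P i ((T ^^ k) x))"
proof -
  obtain K \<rho> where K: "0 \<le> K" "0 < \<rho>" "\<rho> < 1"
    "\<forall>i<n. \<forall>k x. norm (P i ((T ^^ k) x)) \<le> K * \<rho> ^ k * norm x"
    by (rule norm_P_T_pow_le)
  show ?thesis
  proof (rule summable_comparison_test'[OF _ K(4)[rule_format, OF i]])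
    show "summable (\<lambda>k. K * \<rho> ^ k * norm x)"
      using K by (intro summable_mult2 summable_mult summable_geometric) auto
  qed
qed

lemma T_pow_telescope: "x - (T ^^ N) x = (\<Sum>k<N. \<Sum>i<n. P i ((T ^^ k) x))"
  by (induction N) (auto simp: T_def algebra_simps)

text \<open>
  Applying \<open>Q\<close> to \<open>T\<^sup>N x\<close> shifts the series by \<open>N\<close>. So the error of the \<open>N\<close>-th partial sum
  \<open>x - T\<^sup>N x\<close> is \<open>Q (T\<^sup>N x)\<close>.
\<close>
lemma Q_T_pow: "Q ((T ^^ N) x) = Q x - (x - (T ^^ N) x)"
proof -
  have "(\<Sum>k. P i ((T ^^ k) x)) = (\<Sum>k. P i ((T ^^ k) ((T ^^ N) x))) + (\<Sum>k<N. P i ((T ^^ k) x))"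
    if "i < n" for i
    using suminf_split_initial_segment[OF summable_P_T_pow[OF that], of x N]
    by (simp add: funpow_add)
  then have "Q x = Q ((T ^^ N) x) + (\<Sum>i<n. \<Sum>k<N. P i ((T ^^ k) x))"
    by (simp add: Q_def sum.distrib)
  also have "(\<Sum>i<n. \<Sum>k<N. P i ((T ^^ k) x)) = x - (T ^^ N) x"
    by (subst sum.swap) (simp add: T_pow_telescope)
  finally show ?thesis by simp
qed

text \<open>
  The tails are dominated by geometric series. This single estimate gives the convergence in operator
  norm and, for \<open>N = 0\<close>, the boundedness of \<open>Q\<close>.
\<close>
lemma Q_approximation:
  obtains L \<rho> where "0 \<le> L" "0 < \<rho>" "\<rho> < 1"
    "\<forall>N x. norm ((x - (T ^^ N) x) - Q x) \<le> L * \<rho> ^ N * norm x"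
proof -
  obtain K \<rho> where K: "0 \<le> K" "0 < \<rho>" "\<rho> < 1"
    "\<forall>i<n. \<forall>k x. norm (P i ((T ^^ k) x)) \<le> K * \<rho> ^ k * norm x"
    by (rule norm_P_T_pow_le)
  have "norm ((x - (T ^^ N) x) - Q x) \<le> real n * K / (1 - \<rho>) * \<rho> ^ N * norm x" for N x
  proof -
    have le: "norm (P i ((T ^^ k) ((T ^^ N) x))) \<le> (K * \<rho> ^ N * norm x) * \<rho> ^ k"
      if "i < n" for i k
      using K(4)[rule_format, OF that, of "k + N" x] by (simp add: funpow_add power_add mult_ac)
    have geo: "(\<lambda>k. (K * \<rho> ^ N * norm x) * \<rho> ^ k) sums ((K * \<rho> ^ N * norm x) * (1 / (1 - \<rho>)))"
      using K by (intro sums_mult geometric_sums) auto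
    have "norm ((x - (T ^^ N) x) - Q x) = norm (Q ((T ^^ N) x))"
      by (simp add: Q_T_pow norm_minus_commute)
    also have "\<dots> \<le> (\<Sum>i<n. norm (\<Sum>k. P i ((T ^^ k) ((T ^^ N) x))))"
      unfolding Q_def by (rule norm_sum)
    also have "\<dots> \<le> (\<Sum>i<n. K * \<rho> ^ N * norm x * (1 / (1 - \<rho>)))"
    proof (rule sum_mono)
      fix i assume "i \<in> {..<n}"
      then have i: "i < n" by simp
      have "norm (\<Sum>k. P i ((T ^^ k) ((T ^^ N) x))) \<le> (\<Sum>k. (K * \<rho> ^ N * norm x) * \<rho> ^ k)"
        by (rule norm_suminf_le[OF le[OF i] sums_summable[OF geo]])
      then show "norm (\<Sum>k. P i ((T ^^ k) ((T ^^ N) x))) \<le> K * \<rho> ^ N * norm x * (1 / (1 - \<rho>))"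
        using sums_unique[OF geo] by simp
    qed
    finally show ?thesis by (simp add: mult_ac)
  qed
  moreover have "0 \<le> real n * K / (1 - \<rho>)" using K by simp
  ultimately show thesis using K(2,3) by (intro that[of "real n * K / (1 - \<rho>)" \<rho>]) auto
qed

lemma tendsto_T_pow: "(\<lambda>N. (T ^^ N) x) \<longlonglongrightarrow> x - Q x"
proof -
  obtain L \<rho> where L: "0 \<le> L" "0 < \<rho>" "\<rho> < 1"
    "\<forall>N x. norm ((x - (T ^^ N) x) - Q x) \<le> L * \<rho> ^ N * norm x"
    by (rule Q_approximation)
  have "(\<lambda>N. L * \<rho> ^ N * norm x) \<longlonglongrightarrow> L * 0 * norm x"
    using L by (intro tendsto_intros LIMSEQ_realpow_zero) auto
  then have lim: "(\<lambda>N. L * \<rho> ^ N * norm x) \<longlonglongrightarrow> 0" by simp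
  have "(\<lambda>N. (x - (T ^^ N) x) - Q x) \<longlonglongrightarrow> 0"
    by (rule tendsto_0_le[OF lim, of _ 1]) (use L in \<open>auto intro: order_trans[OF _ abs_ge_self]\<close>)
  from tendsto_diff[OF tendsto_const[of "x - Q x"] this] show ?thesis by simp
qed

lemma Q_linear: "Vector_Spaces.linear scale scale Q"
proof (rule linear_scaleI)
  show "Q (x + y) = Q x + Q y" for x y
  proof -
    have "(\<Sum>k. P i ((T ^^ k) (x + y))) = (\<Sum>k. P i ((T ^^ k) x)) + (\<Sum>k. P i ((T ^^ k) y))"
      if "i < n" for i
      using that
      by (simp add: suminf_add summable_P_T_pow linear_add bounded_linear.linear
          bounded_linear_T_pow P_bounded_linear)
    then show ?thesis by (simp add: Q_def sum.distrib)
  qed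
  show "Q (scale c x) = scale c (Q x)" for c x
    by (simp add: Q_def scale_sum_right T_pow_scale P_scale
        bounded_linear.suminf[OF bounded_linear_scale] summable_P_T_pow)
qed

lemma Q_bounded_linear: "bounded_linear Q"
proof -
  obtain L \<rho> where "0 \<le> L" "0 < \<rho>" "\<rho> < 1"
    and L: "\<forall>N x. norm ((x - (T ^^ N) x) - Q x) \<le> L * \<rho> ^ N * norm x"
    by (rule Q_approximation)
  have "norm (Q x) \<le> norm x * L" for x using L[rule_format, of x 0] by (simp add: mult.commute)
  then show ?thesis
    by (intro bounded_linear.intro linear_imp_real_linear[OF Q_linear] bounded_linear_axioms.intro) blast
qed

text \<open>
  Continuity lets \<open>P\<^sub>i\<close> pass into its series, whose terms it fixes; so the limit is a fixed point
  of \<open>P\<^sub>i\<close> and lies in \<open>X\<^sub>i\<close>.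
\<close>
lemma Q_range: "Q x \<in> subspace_sum n X"
proof -
  have "(\<Sum>k. P i ((T ^^ k) x)) \<in> X i" if i: "i < n" for i
  proof -
    have "P i (\<Sum>k. P i ((T ^^ k) x)) = (\<Sum>k. P i (P i ((T ^^ k) x)))"
      by (rule bounded_linear.suminf[OF P_bounded_linear[OF i] summable_P_T_pow[OF i]])
    also have "\<dots> = (\<Sum>k. P i ((T ^^ k) x))" using i by (simp add: P_fix P_range)
    finally show ?thesis using P_range[OF i] by metis
  qed
  then show ?thesis unfolding subspace_sum_def Q_def by blast
qed

text \<open>
  Applying \<open>P\<^sub>i\<close> to the sum expresses \<open>x\<^sub>i\<close> by the vectors \<open>P\<^sub>i x\<^sub>j\<close> with \<open>j \<noteq> i\<close>, so the vector of the
  norms \<open>\<parallel>x\<^sub>i\<parallel>\<close> is dominated by its own image under \<open>E\<close>. Besides independence this shows that the sum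
  of the subspaces meets the common kernel of the projections only in \<open>0\<close>.
\<close>
lemma summands_eq_0_if_P_sum_eq_0:
  assumes x: "\<And>i. i < n \<Longrightarrow> x i \<in> X i" and P0: "\<And>i. i < n \<Longrightarrow> P i (\<Sum>j<n. x j) = 0"
    and i: "i < n"
  shows "x i = 0"
proof -
  have "norm (x i) = 0"
  proof (rule offdiag_subinvariant_eq_0[OF n_ge_1 \<epsilon>_nonneg spectral_radius_less_1 _ _ i])
    fix i assume i: "i < n"
    have "0 = P i (x i) + (\<Sum>j\<in>{..<n} - {i}. P i (x j))"
      using i P0[OF i] unfolding P_sum[OF i] by (simp add: sum.remove[of "{..<n}" i])
    then have "x i = - (\<Sum>j\<in>{..<n} - {i}. P i (x j))"
      using i x by (simp add: P_fix eq_neg_iff_add_eq_0)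
    then have "norm (x i) \<le> (\<Sum>j\<in>{..<n} - {i}. norm (P i (x j)))"
      by (metis norm_minus_cancel norm_sum)
    also have "\<dots> \<le> (\<Sum>j\<in>{..<n} - {i}. \<epsilon> i j * norm (x j))"
      using i x by (intro sum_mono norm_P_le) auto
    finally show "norm (x i) \<le> (\<Sum>j\<in>{..<n} - {i}. \<epsilon> i j * norm (x j))" .
  qed auto
  then show ?thesis by simp
qed

lemma independent: "subspaces_independent n X"
  unfolding subspaces_independent_def
proof (intro allI impI, elim conjE)
  fix x i assume x: "\<forall>i<n. x i \<in> X i" and s: "(\<Sum>i<n. x i) = 0" and i: "i < n"
  show "x i = 0"
    by (rule summands_eq_0_if_P_sum_eq_0)
      (use x i s in \<open>auto simp: linear_0 bounded_linear.linear P_bounded_linear\<close>)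
qed

text \<open>
  The vector \<open>x - Q x\<close> is the limit of \<open>T\<^sup>k x\<close>, and \<open>P\<^sub>i (T\<^sup>k x)\<close> tends to \<open>0\<close>.
\<close>
lemma P_residual_eq_0:
  assumes i: "i < n"
  shows "P i (x - Q x) = 0"
proof -
  have "(\<lambda>N. P i ((T ^^ N) x)) \<longlonglongrightarrow> P i (x - Q x)"
    by (rule bounded_linear.tendsto[OF P_bounded_linear[OF i] tendsto_T_pow])
  moreover have "(\<lambda>N. P i ((T ^^ N) x)) \<longlonglongrightarrow> 0"
    by (rule summable_LIMSEQ_zero[OF summable_P_T_pow[OF i]])
  ultimately show ?thesis by (rule LIMSEQ_unique)
qed

text \<open>
  For \<open>x\<close> in the sum, the residual \<open>x - Q x\<close> lies both in the sum and in the common kernel.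
\<close>
lemma Q_fix:
  assumes x: "x \<in> subspace_sum n X"
  shows "Q x = x"
proof -
  obtain y where y: "x = (\<Sum>i<n. y i)" "\<And>i. i < n \<Longrightarrow> y i \<in> X i"
    using x unfolding subspace_sum_def by auto
  obtain q where q: "Q x = (\<Sum>i<n. q i)" "\<And>i. i < n \<Longrightarrow> q i \<in> X i"
    using Q_range[of x] unfolding subspace_sum_def by auto
  have d: "x - Q x = (\<Sum>i<n. y i - q i)" by (simp add: y(1) q(1)[unfolded y(1)] sum_subtractf)
  have "y i - q i = 0" if "i < n" for i
  proof (rule summands_eq_0_if_P_sum_eq_0[OF _ _ that])
    show "y i - q i \<in> X i" if "i < n" for i
      using y(2) q(2) that
      by (intro subspace_diff is_projection_onto_imp_subspace[OF projection]) auto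
    show "P i (\<Sum>j<n. y j - q j) = 0" if "i < n" for i
      using P_residual_eq_0[OF that, of x] unfolding d .
  qed
  then have "x - Q x = 0" unfolding d by simp
  then show ?thesis by simp
qed

text \<open>
  If \<open>Q x = 0\<close>, then \<open>x\<close> is its own residual and is annihilated by every \<open>P\<^sub>i\<close>. Conversely, \<open>T\<close> fixes
  every vector of the common kernel, so \<open>x = lim T\<^sup>k x = x - Q x\<close>.
\<close>
lemma null_space_Q: "null_space Q = (\<Inter>i<n. null_space (P i))"
proof (intro subset_antisym subsetI)
  fix x assume "x \<in> null_space Q"
  then show "x \<in> (\<Inter>i<n. null_space (P i))"
    using P_residual_eq_0[of _ x] by (simp add: null_space_def)
next
  fix x assume "x \<in> (\<Inter>i<n. null_space (P i))"
  then have "\<And>i. i < n \<Longrightarrow> P i x = 0" by (simp add: null_space_def)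
  then have "(T ^^ k) x = x" for k by (induction k) (simp_all add: T_def)
  then have "(\<lambda>N. x) \<longlonglongrightarrow> x - Q x" using tendsto_T_pow[of x] by simp
  then show "x \<in> null_space Q" by (simp add: null_space_def LIMSEQ_const_iff)
qed

lemma Q_projection: "is_projection_onto scale Q (subspace_sum n X)"
  unfolding is_projection_onto_def
  using Q_linear Q_range Q_fix bounded_linear.continuous_on[OF Q_bounded_linear continuous_on_id] by blast

lemma onorm_tendsto: "(\<lambda>N. onorm (\<lambda>x. (x - (T ^^ N) x) - Q x)) \<longlonglongrightarrow> 0"
proof -
  obtain L \<rho> where L: "0 \<le> L" "0 < \<rho>" "\<rho> < 1"
    "\<forall>N x. norm ((x - (T ^^ N) x) - Q x) \<le> L * \<rho> ^ N * norm x"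
    by (rule Q_approximation)
  have "(\<lambda>N. L * \<rho> ^ N) \<longlonglongrightarrow> L * 0"
    using L by (intro tendsto_intros LIMSEQ_realpow_zero) auto
  then have lim: "(\<lambda>N. L * \<rho> ^ N) \<longlonglongrightarrow> 0" by simp
  have "0 \<le> onorm (\<lambda>x. (x - (T ^^ N) x) - Q x)" for N
    by (intro onorm_pos_le bounded_linear_sub bounded_linear_ident bounded_linear_T_pow Q_bounded_linear)
  moreover have "onorm (\<lambda>x. (x - (T ^^ N) x) - Q x) \<le> L * \<rho> ^ N" for N
    using L by (intro onorm_bound) auto
  ultimately show ?thesis
    by (intro tendsto_sandwich[OF _ _ tendsto_const lim]) auto
qed

end

theorem theorem2p1:
  fixes scale :: "'k::real_normed_field \<Rightarrow> 'a::banach \<Rightarrow> 'a"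
    and n :: nat
    and X :: "nat \<Rightarrow> 'a set"
    and P :: "nat \<Rightarrow> 'a \<Rightarrow> 'a"
    and \<epsilon> :: "nat \<Rightarrow> nat \<Rightarrow> real"
    and A :: "'a \<Rightarrow> 'a"
  assumes "normed_scaling scale"
    and "n \<ge> 1"
    and "\<And>i. i < n \<Longrightarrow> complemented scale (X i)"
    and "\<And>i. i < n \<Longrightarrow> is_projection_onto scale (P i) (X i)"
    and "\<And>i j. i < n \<Longrightarrow> j < n \<Longrightarrow> i \<noteq> j \<Longrightarrow> 0 \<le> \<epsilon> i j"
    and "\<And>i j x. i < n \<Longrightarrow> j < n \<Longrightarrow> i \<noteq> j \<Longrightarrow> x \<in> X j \<Longrightarrow> norm (P i x) \<le> \<epsilon> i j * norm x"
    and "A = (\<lambda>x. \<Sum>i<n. P i x)"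
    and "spectral_radius (offdiag_mat n \<epsilon>) < 1"
  shows "subspaces_independent n X \<and>
    complemented scale (subspace_sum n X) \<and>
    is_complement scale (subspace_sum n X) (\<Inter>i<n. null_space (P i)) \<and>
    (\<exists>Q. is_projection_onto scale Q (subspace_sum n X) \<and>
         null_space Q = (\<Inter>i<n. null_space (P i)) \<and>
         (\<lambda>N. onorm (\<lambda>x. (x - ((\<lambda>y. y - A y) ^^ N) x) - Q x)) \<longlonglongrightarrow> 0)"
proof -
  interpret small_interaction_projections scale n X P \<epsilon>
    using assms by (intro small_interaction_projections.intro small_interaction_projections_axioms.intro) auto
  have "is_complement scale (subspace_sum n X) (\<Inter>i<n. null_space (P i))"
    using is_complement_null_space[OF Q_projection] unfolding null_space_Q .
  moreover have "(\<lambda>y. y - A y) = T"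
    unfolding assms(7) by (simp add: fun_eq_iff T_def)
  ultimately show ?thesis
    using independent Q_projection null_space_Q onorm_tendsto
    unfolding complemented_def by auto
qed

end
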